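(* Consider a sequence of triples $(u, n, R)$, where $u\in(0,1)$ is a unit roundoff, $n\ge 1$ is an integer and $R\in\mathbb{R}^{n\times n}$ is nonsingular, and let all asymptotic symbols refer to the limit along this sequence. Let $\mathrm{fl}(R^{\mathsf T}R)$ be the floating point product of $R^{\mathsf T}$ and $R$ computed with unit roundoff $u$. Suppose that $n\sqrt{u}\to 0$ and that $\kappa(R)=\sigma_1(R)/\sigma_n(R)=\dfrac{1}{o(n\sqrt{u})}$, i.e. $\dfrac{1}{\kappa(R)}=o(n\sqrt u)$. Define the real number $t_n$ by $$\sigma_n(\mathrm{fl}(R^{\mathsf T}R))=\sigma_n(R)^2+t_n\, n\gamma_n\,\sigma_1(R)^2,\qquad \gamma_n=\frac{nu}{1-nu},$$ and suppose (genericity) that $|t_n|$ is bounded away from $0$ along the sequence. Then, along the sequence, $t_n>0$ for all sufficiently late terms, $t_n=O(1)$, $1/t_n=O(1)$, $$\sigma_n(\mathrm{fl}(R^{\mathsf T}R))\approx \sigma_1(R)^2\,t_n\,n^2u ,$$ where $\approx$ means that the ratio of the two sides tends to $1$, and $$\kappa(\mathrm{fl}(R^{\mathsf T}R))=O\!\left(\frac{1}{n^2u}\right).$$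
   Context: For $M\in\mathbb{R}^{n\times n}$, $\sigma_1(M)\ge\cdots\ge\sigma_n(M)\ge 0$ are the singular values of $M$ and $\kappa(M)=\sigma_1(M)/\sigma_n(M)$. For a matrix $M=(m_{ij})$, $|M|=(|m_{ij}|)$, and inequalities between matrices are entrywise. Floating point arithmetic with unit roundoff $u$ enters only through the standard bound for matrix products: whenever $nu<1$, the computed matrix $\mathrm{fl}(R^{\mathsf T}R)\in\mathbb{R}^{n\times n}$ is symmetric and satisfies $|\mathrm{fl}(R^{\mathsf T}R)-R^{\mathsf T}R|\le\gamma_n|R^{\mathsf T}||R|$ with $\gamma_n=nu/(1-nu)$. Landau symbols: $f=O(g)$ means $f/g$ is bounded and $f=o(g)$ means $f/g\to 0$ in the limit considered. *)

theory Defs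
  imports
    "HOL-Library.Landau_Symbols"
    "HOL-Library.Multiset"
    "HOL-Computational_Algebra.Polynomial"
    "Jordan_Normal_Form.Char_Poly"
begin

text \<open>
  For \<open>i = 1, \<dots>, n\<close>, the \<open>i\<close>-th largest singular value of an \<open>n \<times> n\<close> matrix \<open>M\<close>: the square root
  of the \<open>i\<close>-th largest eigenvalue of \<open>M\<^sup>T M\<close>, counted with multiplicity as a root of the
  characteristic polynomial. All \<open>n\<close> of these roots are real and nonnegative because \<open>M\<^sup>T M\<close> is
  symmetric positive semidefinite. The value is unspecified for \<open>i\<close> outside \<open>{1..n}\<close>.
\<close>
definition singular_value :: "nat \<Rightarrow> real mat \<Rightarrow> real" where
  "singular_value i M =
     sqrt (rev (sorted_list_of_multiset (proots (char_poly (transpose_mat M * M)))) ! (i - 1))"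

text \<open>
  Because \<open>x / 0 = 0\<close>, this is the usual condition number only where the smallest singular value is
  nonzero.
\<close>
definition cond_number :: "real mat \<Rightarrow> real" where
  "cond_number M = singular_value 1 M / singular_value (dim_row M) M"

definition gamma_const :: "real \<Rightarrow> nat \<Rightarrow> real" where
  "gamma_const u n = real n * u / (1 - real n * u)"

text \<open>
  \<open>F\<close> is an admissible result of computing \<open>R\<^sup>T R\<close> with unit roundoff \<open>u\<close>. The rounding error
  analysis only says something for \<open>n u < 1\<close>, so nothing but the dimension is known otherwise.
\<close>
definition fl_gram :: "real \<Rightarrow> nat \<Rightarrow> real mat \<Rightarrow> real mat \<Rightarrow> bool" where
  "fl_gram u n R F \<longleftrightarrow>
     F \<in> carrier_mat n n \<and>
     (real n * u < 1 \<longrightarrow>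
        transpose_mat F = F \<and>
        map_mat abs (F - transpose_mat R * R)
          \<le> gamma_const u n \<cdot>\<^sub>m (map_mat abs (transpose_mat R) * map_mat abs R))"

end

theory Submission
  imports Defs "HOL-Analysis.Function_Topology" "HOL-Analysis.L2_Norm"
begin

text \<open>
  Let \<open>E = F - R\<^sup>T R\<close>. Every entry of \<open>|R\<^sup>T| |R|\<close> is at most \<open>\<sigma>\<^sub>1(R)\<^sup>2\<close>, so \<open>\<parallel>E x\<parallel> \<le> n \<gamma>\<^sub>n \<sigma>\<^sub>1(R)\<^sup>2 \<parallel>x\<parallel>\<close>.
  Testing \<open>F\<close> on a last right singular vector of \<open>R\<close> gives
  \<open>\<sigma>\<^sub>n(F) \<le> \<sigma>\<^sub>n(R)\<^sup>2 + n \<gamma>\<^sub>n \<sigma>\<^sub>1(R)\<^sup>2\<close>, hence \<open>t \<le> 1\<close>, and likewise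
  \<open>\<sigma>\<^sub>1(F) \<le> (1 + n \<gamma>\<^sub>n) \<sigma>\<^sub>1(R)\<^sup>2\<close>. The hypothesis on \<open>\<kappa>(R)\<close> says that
  \<open>\<rho> = \<sigma>\<^sub>n(R)\<^sup>2 / (\<sigma>\<^sub>1(R)\<^sup>2 n\<^sup>2 u) \<rightarrow> 0\<close>, and the definition of \<open>t\<close> reads
  \<open>\<sigma>\<^sub>n(F) = \<sigma>\<^sub>1(R)\<^sup>2 n\<^sup>2 u (\<rho> + t / (1 - n u))\<close>. The left side is nonnegative, so \<open>t\<close>, being bounded
  away from \<open>0\<close>, is eventually positive, and it dominates \<open>\<rho>\<close>.
\<close>

subsection \<open>Real symmetric matrices\<close>

text \<open>Induction on the degree. The fundamental theorem of algebra gives a complex root, which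
  is real by hypothesis, so \<open>[:-r, 1:]\<close> splits off over the reals; the quotient
  inherits the hypothesis because its roots are roots of \<open>p\<close>.\<close>

lemma size_proots_of_real_roots:
  fixes p :: "real poly"
  assumes "p \<noteq> 0" and "\<And>z. poly (map_poly complex_of_real p) z = 0 \<Longrightarrow> z \<in> \<real>"
  shows "size (proots p) = degree p"
  using assms
proof (induction "degree p" arbitrary: p rule: less_induct)
  case less
  interpret map_poly_comm_ring_hom complex_of_real ..
  show ?case
  proof (cases "degree p = 0")
    case True
    then show ?thesis using size_proots_le[of p] by simp
  next
    case False
    then have "\<not> constant (poly (map_poly complex_of_real p))"
      by (simp add: constant_degree)
    then obtain z where z: "poly (map_poly complex_of_real p) z = 0"
      using fundamental_theorem_of_algebra by blast
    with less.prems(2) obtain r where "z = complex_of_real r" by (auto elim: Reals_cases)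
    with z have "poly p r = 0" by simp
    then obtain q where q: "p = [:-r, 1:] * q" by (auto simp: poly_eq_0_iff_dvd elim: dvdE)
    with less.prems(1) have "q \<noteq> 0" by auto
    then have deg: "degree p = Suc (degree q)" by (simp add: q degree_mult_eq del: mult_pCons_left)
    have "size (proots q) = degree q"
    proof (rule less.hyps)
      show "z \<in> \<real>" if "poly (map_poly complex_of_real q) z = 0" for z
        using that less.prems(2)[of z] by (simp add: q hom_mult del: mult_pCons_left)
    qed (use deg \<open>q \<noteq> 0\<close> in auto)
    moreover have "proots p = proots [:-r, 1:] + proots q"
      unfolding q using \<open>q \<noteq> 0\<close> by (intro proots_mult) auto
    ultimately show ?thesis using deg by simp
  qed
qed

lemma sym_scalar_prod:
  fixes A :: "real mat"
  assumes "A \<in> carrier_mat n n" "transpose_mat A = A" "x \<in> carrier_vec n" "y \<in> carrier_vec n"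
  shows "(A *\<^sub>v x) \<bullet> y = x \<bullet> (A *\<^sub>v y)"
  using transpose_vec_mult_scalar[of A n n y x] assms by metis

lemma scalar_prod_self_nonneg: "0 \<le> (x :: real vec) \<bullet> x"
  by (simp add: scalar_prod_def sum_nonneg)

lemma scalar_prod_self_eq_0:
  assumes "(x :: real vec) \<in> carrier_vec n" shows "x \<bullet> x = 0 \<longleftrightarrow> x = 0\<^sub>v n"
  using assms by (auto simp: scalar_prod_def sum_nonneg_eq_0_iff)

text \<open>For an eigenvector \<open>v = x + i y\<close>, the real and imaginary parts of the
  eigenvalue equation express \<open>A x\<close> and \<open>A y\<close> through \<open>x\<close> and
  \<open>y\<close>. Inserted into the symmetry relation between \<open>A x\<close> and
  \<open>A y\<close>, they leave \<open>Im z\<close> times the positive number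
  \<open>x \<bullet> x + y \<bullet> y\<close> equal to zero.\<close>

lemma sym_complex_eigenvalue_real:
  fixes A :: "real mat"
  assumes A: "A \<in> carrier_mat n n" "transpose_mat A = A"
    and ev: "eigenvalue (map_mat complex_of_real A) z"
  shows "z \<in> \<real>"
proof -
  obtain v where v: "v \<in> carrier_vec n" "v \<noteq> 0\<^sub>v n" "map_mat complex_of_real A *\<^sub>v v = z \<cdot>\<^sub>v v"
    using ev A by (auto simp: eigenvalue_def eigenvector_def)
  define x where "x = map_vec Re v"
  define y where "y = map_vec Im v"
  have xy: "x \<in> carrier_vec n" "y \<in> carrier_vec n" using v by (auto simp: x_def y_def)
  have eq: "(\<Sum>j<n. complex_of_real (A $$ (i,j)) * v $ j) = z * v $ i" if "i < n" for i
    using arg_cong[OF v(3), of "\<lambda>w. w $ i"] that A v(1)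
    by (simp add: mult_mat_vec_def scalar_prod_def row_def atLeast0LessThan)
  have Ax: "A *\<^sub>v x = Re z \<cdot>\<^sub>v x - Im z \<cdot>\<^sub>v y"
  proof (rule eq_vecI)
    show "(A *\<^sub>v x) $ i = (Re z \<cdot>\<^sub>v x - Im z \<cdot>\<^sub>v y) $ i" if "i < dim_vec (Re z \<cdot>\<^sub>v x - Im z \<cdot>\<^sub>v y)" for i
      using that xy A v(1) arg_cong[OF eq[of i], of Re]
      by (simp add: x_def y_def mult_mat_vec_def scalar_prod_def row_def atLeast0LessThan)
  qed (use xy A in auto)
  have Ay: "A *\<^sub>v y = Re z \<cdot>\<^sub>v y + Im z \<cdot>\<^sub>v x"
  proof (rule eq_vecI)
    show "(A *\<^sub>v y) $ i = (Re z \<cdot>\<^sub>v y + Im z \<cdot>\<^sub>v x) $ i" if "i < dim_vec (Re z \<cdot>\<^sub>v y + Im z \<cdot>\<^sub>v x)" for i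
      using that xy A v(1) arg_cong[OF eq[of i], of Im]
      by (simp add: x_def y_def mult_mat_vec_def scalar_prod_def row_def atLeast0LessThan)
  qed (use xy A in auto)
  have "(A *\<^sub>v x) \<bullet> y = x \<bullet> (A *\<^sub>v y)" using A xy by (rule sym_scalar_prod)
  then have "Im z * (x \<bullet> x + y \<bullet> y) = 0"
    using xy unfolding Ax Ay
    by (simp add: minus_scalar_prod_distrib[of _ n] scalar_prod_add_distrib[of _ n] algebra_simps)
  moreover have "x \<bullet> x + y \<bullet> y \<noteq> 0"
  proof
    assume "x \<bullet> x + y \<bullet> y = 0"
    then have "x \<bullet> x = 0" "y \<bullet> y = 0"
      using scalar_prod_self_nonneg[of x] scalar_prod_self_nonneg[of y] by linarith+
    then have "x = 0\<^sub>v n" "y = 0\<^sub>v n" using xy scalar_prod_self_eq_0 by blast+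
    then have "Re (v $ i) = 0" "Im (v $ i) = 0" if "i < n" for i
      using that v(1) unfolding x_def y_def by (metis carrier_vecD index_map_vec(1) index_zero_vec(1))+
    then have "v $ i = 0" if "i < n" for i
      using that by (simp add: complex_eq_iff)
    with v(1,2) show False by (metis carrier_vecD eq_vecI index_zero_vec)
  qed
  ultimately show ?thesis by (simp add: complex_is_Real_iff)
qed

text \<open>This ensures that the eigenvalue list in \<open>singular_value\<close> has exactly
  \<open>n\<close> entries, so that the indices \<open>0\<close> to \<open>n - 1\<close> are in
  range.\<close>

lemma size_proots_char_poly_sym:
  fixes A :: "real mat"
  assumes A: "A \<in> carrier_mat n n" "transpose_mat A = A"
  shows "size (proots (char_poly A)) = n"
proof -
  have "char_poly A \<noteq> 0" using degree_monic_char_poly[OF A(1)] by auto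
  moreover have "z \<in> \<real>" if "poly (map_poly complex_of_real (char_poly A)) z = 0" for z
    using that eigenvalue_root_char_poly[of "map_mat complex_of_real A" n z] A
    by (intro sym_complex_eigenvalue_real[OF A]) (simp add: of_real_hom.char_poly_hom[OF A(1)])
  ultimately show ?thesis using size_proots_of_real_roots degree_monic_char_poly[OF A(1)] by metis
qed

text \<open>Vectors are coded as functions vanishing from \<open>n\<close> on. The sphere is then a
  closed part of a product of intervals \<open>{-1..1}\<close> and singletons \<open>{0}\<close>,
  which is compact by Tychonoff.\<close>

lemma compact_unit_sphere_fun:
  "compact {f :: nat \<Rightarrow> real. (\<forall>i\<ge>n. f i = 0) \<and> (\<Sum>i<n. (f i)\<^sup>2) = 1}"
proof -
  let ?S = "\<lambda>i. if i < n then {-1..1::real} else {0}"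
  let ?C = "{f :: nat \<Rightarrow> real. (\<Sum>i<n. (f i)\<^sup>2) = 1}"
  have "compactin (product_topology (\<lambda>i. euclidean) UNIV) (PiE UNIV ?S)"
    unfolding compactin_PiE by auto
  then have "compact (PiE UNIV ?S)" by (simp add: euclidean_product_topology)
  moreover have "closed ?C"
    by (intro closed_Collect_eq continuous_intros continuous_on_product_coordinates)
  ultimately have "compact (PiE UNIV ?S \<inter> ?C)" by (rule compact_Int_closed)
  moreover have "\<bar>f i\<bar> \<le> 1" if "(\<Sum>i<n. (f i)\<^sup>2) = 1" "i < n" for f :: "nat \<Rightarrow> real" and i
  proof -
    have "(f i)\<^sup>2 \<le> (\<Sum>i<n. (f i)\<^sup>2)" using that by (intro member_le_sum) auto
    with that show ?thesis by (simp add: abs_square_le_1)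
  qed
  then have "PiE UNIV ?S \<inter> ?C = {f. (\<forall>i\<ge>n. f i = 0) \<and> (\<Sum>i<n. (f i)\<^sup>2) = 1}"
    by (auto simp: PiE_def Pi_def abs_le_iff)
  ultimately show ?thesis by simp
qed

text \<open>
  A maximiser \<open>v\<close> of the Rayleigh quotient over the unit sphere is an eigenvector: otherwise, moving
  \<open>v\<close> a little against the residual \<open>w = l v - A v\<close> would increase the quotient above \<open>l\<close>.
\<close>
lemma sym_max_eigenvector:
  fixes A :: "real mat"
  assumes A: "A \<in> carrier_mat n n" "transpose_mat A = A" and n: "n > 0"
  shows "\<exists>l v. eigenvector A v l \<and> (\<forall>x\<in>carrier_vec n. x \<bullet> (A *\<^sub>v x) \<le> l * (x \<bullet> x))"
proof -
  define K where "K = {f :: nat \<Rightarrow> real. (\<forall>i\<ge>n. f i = 0) \<and> (\<Sum>i<n. (f i)\<^sup>2) = 1}"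
  define q where "q f = (\<Sum>i<n. f i * (\<Sum>j<n. A $$ (i,j) * f j))" for f :: "nat \<Rightarrow> real"
  have q: "vec n f \<bullet> (A *\<^sub>v vec n f) = q f" for f
    using A(1) by (simp add: q_def mult_mat_vec_def scalar_prod_def row_def atLeast0LessThan)
  have ss: "vec n f \<bullet> vec n f = (\<Sum>i<n. (f i)\<^sup>2)" for f :: "nat \<Rightarrow> real"
    by (simp add: scalar_prod_def atLeast0LessThan power2_eq_square)
  have "(\<lambda>i. if i = 0 then 1 else 0) \<in> K"
    using n by (auto simp: K_def if_distrib[of "\<lambda>x. x ^ 2"] cong: if_cong)
  then have "K \<noteq> {}" by blast
  moreover have "compact K" unfolding K_def by (rule compact_unit_sphere_fun)
  moreover have "continuous_on UNIV q"
    unfolding q_def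
    by (intro continuous_on_sum continuous_on_mult continuous_on_const continuous_on_product_coordinates)
  then have "continuous_on K q" by (rule continuous_on_subset) simp
  ultimately have "\<exists>g\<in>K. \<forall>f\<in>K. q f \<le> q g" by (intro continuous_attains_sup)
  then obtain g where g: "g \<in> K" "\<And>f. f \<in> K \<Longrightarrow> q f \<le> q g" by blast
  define v where "v = vec n g"
  define l where "l = v \<bullet> (A *\<^sub>v v)"
  have v: "v \<in> carrier_vec n" "v \<bullet> v = 1" using g(1) by (auto simp: v_def ss K_def)
  have max: "x \<bullet> (A *\<^sub>v x) \<le> l * (x \<bullet> x)" if x: "x \<in> carrier_vec n" for x
  proof (cases "x \<bullet> x = 0")
    case True
    then have "x = 0\<^sub>v n" using scalar_prod_self_eq_0[OF x] by simp
    then show ?thesis using A by simp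
  next
    case False
    define r where "r = sqrt (x \<bullet> x)"
    have r: "r > 0" "r\<^sup>2 = x \<bullet> x"
      using False scalar_prod_self_nonneg[of x] by (auto simp: r_def)
    define f where "f i = (if i < n then x $ i / r else 0)" for i
    have fx: "vec n f = (1/r) \<cdot>\<^sub>v x" using x by (auto simp: f_def)
    have "vec n f \<bullet> vec n f = 1" using x r False by (simp add: fx power2_eq_square field_simps)
    then have "f \<in> K" by (auto simp: K_def ss f_def)
    then have "vec n f \<bullet> (A *\<^sub>v vec n f) \<le> l" using g(2) unfolding l_def v_def q by blast
    moreover have "vec n f \<bullet> (A *\<^sub>v vec n f) = (x \<bullet> (A *\<^sub>v x)) / r\<^sup>2"
      using x A by (simp add: fx mult_mat_vec[OF A(1) x] power2_eq_square scalar_prod_smult_distrib[of _ n] smult_scalar_prod_distrib[of _ n])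
    moreover have "x \<bullet> x > 0" using False scalar_prod_self_nonneg[of x] by simp
    ultimately show ?thesis using r by (simp add: pos_divide_le_eq)
  qed
  define w where "w = l \<cdot>\<^sub>v v - A *\<^sub>v v"
  have w: "w \<in> carrier_vec n" using v A by (simp add: w_def)
  have Av: "A *\<^sub>v v \<in> carrier_vec n" "A *\<^sub>v w \<in> carrier_vec n" using v w A by auto
  \<comment> \<open>Along \<open>v + s w\<close>, the form
    \<open>l * (x \<bullet> x) - x \<bullet> A x\<close> is a quadratic polynomial in
    \<open>s\<close>. Its constant term vanishes by the choice of \<open>l\<close>, its linear
    coefficient is \<open>2 * (w \<bullet> w)\<close>, its quadratic one is \<open>c\<close>, and by
    \<open>max\<close> it is never negative.\<close>
  define c where "c = l * (w \<bullet> w) - w \<bullet> (A *\<^sub>v w)"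
  have ww: "w \<bullet> w = l * (v \<bullet> w) - w \<bullet> (A *\<^sub>v v)"
    using v w Av
    by (subst (1) w_def) (simp add: minus_scalar_prod_distrib[of _ n] comm_scalar_prod[of "A *\<^sub>v v" n w])
  have pert: "0 \<le> 2 * s * (w \<bullet> w) + s\<^sup>2 * c" for s
  proof -
    have "(v + s \<cdot>\<^sub>v w) \<bullet> (A *\<^sub>v (v + s \<cdot>\<^sub>v w)) \<le> l * ((v + s \<cdot>\<^sub>v w) \<bullet> (v + s \<cdot>\<^sub>v w))"
      using v w by (intro max) auto
    moreover have "A *\<^sub>v (v + s \<cdot>\<^sub>v w) = A *\<^sub>v v + s \<cdot>\<^sub>v (A *\<^sub>v w)"
      using v w A by (simp add: mult_add_distrib_mat_vec[of _ n n] mult_mat_vec[of _ n n])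
    moreover have "v \<bullet> (A *\<^sub>v w) = w \<bullet> (A *\<^sub>v v)"
      using sym_scalar_prod[OF A v(1) w] comm_scalar_prod[OF w Av(1)] by simp
    moreover have "w \<bullet> v = v \<bullet> w" using v w comm_scalar_prod by blast
    ultimately have "0 \<le> 2 * s * (l * (v \<bullet> w) - w \<bullet> (A *\<^sub>v v)) + s\<^sup>2 * (l * (w \<bullet> w) - w \<bullet> (A *\<^sub>v w))"
      using v w Av l_def
      by (simp add: add_scalar_prod_distrib[of _ n] scalar_prod_add_distrib[of _ n] algebra_simps power2_eq_square)
    then show ?thesis by (simp only: c_def ww[symmetric])
  qed
  have "w \<bullet> w = 0"
  proof (rule ccontr)
    assume "w \<bullet> w \<noteq> 0"
    then have pos: "w \<bullet> w > 0" using scalar_prod_self_nonneg[of w] by simp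
    \<comment> \<open>With \<open>d > \<bar>c\<bar>\<close>, the step
      \<open>s = - (w \<bullet> w) / d\<close> is short enough for the negative linear term to
      outweigh the quadratic one.\<close>
    define d where "d = \<bar>c\<bar> + 1"
    have d: "d > 0" "c - 2 * d < 0" by (auto simp: d_def)
    have "0 \<le> 2 * (- (w \<bullet> w / d)) * (w \<bullet> w) + (- (w \<bullet> w / d))\<^sup>2 * c" by (rule pert)
    also have "\<dots> = (w \<bullet> w)\<^sup>2 / d\<^sup>2 * (c - 2 * d)"
      using d(1) by (simp add: field_simps power2_eq_square)
    also have "\<dots> < 0"
      using pos d by (intro mult_pos_neg divide_pos_pos) auto
    finally show False by simp
  qed
  then have "w = 0\<^sub>v n" using scalar_prod_self_eq_0[OF w] by simp
  then have "w $ i = 0" if "i < n" for i using that by simp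
  then have "A *\<^sub>v v = l \<cdot>\<^sub>v v"
    using v A by (intro eq_vecI) (auto simp: w_def)
  moreover have "v \<noteq> 0\<^sub>v n" using v by auto
  ultimately have "eigenvector A v l" using A v by (simp add: eigenvector_def)
  with max show ?thesis by blast
qed

subsection \<open>Singular values\<close>

text \<open>The Euclidean norm, written through \<open>L2_set\<close> to inherit its triangle and
  Cauchy-Schwarz inequalities.\<close>

definition vec_norm2 :: "real vec \<Rightarrow> real" where
  "vec_norm2 v = L2_set (($) v) {..<dim_vec v}"

lemma vec_norm2_sq: "(vec_norm2 v)\<^sup>2 = v \<bullet> v"
  by (simp add: vec_norm2_def L2_set_def sum_nonneg scalar_prod_def atLeast0LessThan power2_eq_square)

lemma vec_norm2_nonneg: "0 \<le> vec_norm2 v"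
  by (simp add: vec_norm2_def)

lemma vec_norm2_pos:
  assumes "v \<in> carrier_vec n" "v \<noteq> 0\<^sub>v n" shows "0 < vec_norm2 v"
proof -
  have "(vec_norm2 v)\<^sup>2 \<noteq> 0"
    using assms scalar_prod_self_eq_0 unfolding vec_norm2_sq by blast
  then show ?thesis using vec_norm2_nonneg[of v] by (simp add: less_le)
qed

lemma vec_norm2_add:
  assumes "v \<in> carrier_vec n" "w \<in> carrier_vec n"
  shows "vec_norm2 (v + w) \<le> vec_norm2 v + vec_norm2 w"
  using L2_set_triangle_ineq[of "($) v" "($) w" "{..<n}"] assms
  by (simp add: vec_norm2_def cong: L2_set_cong_simp)

lemma vec_norm2_smult: "vec_norm2 (c \<cdot>\<^sub>v v) = \<bar>c\<bar> * vec_norm2 v"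
proof -
  have "(vec_norm2 (c \<cdot>\<^sub>v v))\<^sup>2 = (\<bar>c\<bar> * vec_norm2 v)\<^sup>2"
    by (simp add: vec_norm2_sq power_mult_distrib) (simp add: power2_eq_square)
  then show ?thesis using vec_norm2_nonneg by (simp add: power2_eq_iff_nonneg)
qed

lemma scalar_prod_le_vec_norm2:
  assumes "v \<in> carrier_vec n" "w \<in> carrier_vec n"
  shows "v \<bullet> w \<le> vec_norm2 v * vec_norm2 w"
proof -
  have "v \<bullet> w \<le> (\<Sum>i<n. \<bar>v $ i\<bar> * \<bar>w $ i\<bar>)"
    using assms by (auto simp: scalar_prod_def atLeast0LessThan abs_mult[symmetric] intro!: sum_mono)
  also have "\<dots> \<le> vec_norm2 v * vec_norm2 w"
    using L2_set_mult_ineq[of "($) v" "($) w" "{..<n}"] assms by (simp add: vec_norm2_def)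
  finally show ?thesis .
qed

section \<open>Spectrum of the Gram matrix; the extreme singular values as bounds on
  stretching\<close>

lemma gram_carrier:
  "M \<in> carrier_mat n n \<Longrightarrow> transpose_mat M * M \<in> carrier_mat n n"
  by auto

lemma gram_sym:
  fixes M :: "real mat" shows "M \<in> carrier_mat n n \<Longrightarrow> transpose_mat (transpose_mat M * M) = transpose_mat M * M"
  by (subst transpose_mult[of _ n n]) auto

lemma gram_quadratic_form:
  assumes "M \<in> carrier_mat n n" "x \<in> carrier_vec n"
  shows "x \<bullet> ((transpose_mat M * M) *\<^sub>v x) = (vec_norm2 (M *\<^sub>v x))\<^sup>2"
  using assms transpose_vec_mult_scalar[of M n n x "M *\<^sub>v x"]
  by (simp add: vec_norm2_sq assoc_mult_mat_vec[of _ n n] comm_scalar_prod[of x n])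

text \<open>Connects the list in the definition of \<open>singular_value\<close> with the spectrum:
  the eigenvalues stand in it in decreasing order, so the extreme ones are its first and last
  entries.\<close>

lemma gram_eigenvalues:
  fixes M :: "real mat"
  assumes M: "M \<in> carrier_mat n n"
  defines "l \<equiv> rev (sorted_list_of_multiset (proots (char_poly (transpose_mat M * M))))"
  shows "length l = n" "sorted_wrt (\<ge>) l" "set l = {e. eigenvalue (transpose_mat M * M) e}"
proof -
  let ?A = "transpose_mat M * M"
  note A = gram_carrier[OF M] gram_sym[OF M]
  have "char_poly ?A \<noteq> 0" using degree_monic_char_poly[OF A(1)] by auto
  then show "set l = {e. eigenvalue ?A e}"
    by (simp add: l_def eigenvalue_root_char_poly[OF A(1)])
  have "length l = size (mset l)" by simp
  also have "mset l = proots (char_poly ?A)" by (simp add: l_def)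
  finally show "length l = n" using size_proots_char_poly_sym[OF A] by simp
  show "sorted_wrt (\<ge>) l" by (simp add: l_def sorted_wrt_rev)
qed

lemma gram_eigenvector:
  assumes M: "M \<in> carrier_mat n n" and "eigenvalue (transpose_mat M * M) e"
  obtains v where "v \<in> carrier_vec n" "v \<noteq> 0\<^sub>v n" "(transpose_mat M * M) *\<^sub>v v = e \<cdot>\<^sub>v v" "e \<ge> 0"
    "(vec_norm2 (M *\<^sub>v v))\<^sup>2 = e * (vec_norm2 v)\<^sup>2"
proof -
  obtain v where v: "v \<in> carrier_vec n" "v \<noteq> 0\<^sub>v n" "(transpose_mat M * M) *\<^sub>v v = e \<cdot>\<^sub>v v"
    using assms by (auto simp: eigenvalue_def eigenvector_def)
  have eq: "(vec_norm2 (M *\<^sub>v v))\<^sup>2 = e * (vec_norm2 v)\<^sup>2"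
    using gram_quadratic_form[OF M v(1)] v by (simp add: vec_norm2_sq)
  have "0 \<le> e * (vec_norm2 v)\<^sup>2" unfolding eq[symmetric] by simp
  then have "e \<ge> 0" using vec_norm2_pos[OF v(1,2)] by (simp add: zero_le_mult_iff)
  with v eq show thesis using that by blast
qed

text \<open>The eigenvalue under the root is nonnegative, so the square of the singular value
  recovers it; \<open>v\<close> is a right singular vector.\<close>

lemma singular_value_eigenvector:
  assumes M: "M \<in> carrier_mat n n" and i: "1 \<le> i" "i \<le> n"
  obtains v where "v \<in> carrier_vec n" "v \<noteq> 0\<^sub>v n"
    "(transpose_mat M * M) *\<^sub>v v = (singular_value i M)\<^sup>2 \<cdot>\<^sub>v v"
    "vec_norm2 (M *\<^sub>v v) = singular_value i M * vec_norm2 v" "0 \<le> singular_value i M"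
proof -
  define e where "e = rev (sorted_list_of_multiset (proots (char_poly (transpose_mat M * M)))) ! (i - 1)"
  have "eigenvalue (transpose_mat M * M) e"
    using gram_eigenvalues[OF M] i unfolding e_def by (metis One_nat_def Suc_le_lessD Suc_pred' le_eq_less_or_eq mem_Collect_eq nth_mem order_less_le_trans)
  then obtain v where v: "v \<in> carrier_vec n" "v \<noteq> 0\<^sub>v n" "(transpose_mat M * M) *\<^sub>v v = e \<cdot>\<^sub>v v"
      "e \<ge> 0" "(vec_norm2 (M *\<^sub>v v))\<^sup>2 = e * (vec_norm2 v)\<^sup>2"
    by (rule gram_eigenvector[OF M])
  have s: "singular_value i M = sqrt e" by (simp add: singular_value_def e_def)
  have "vec_norm2 (M *\<^sub>v v) = sqrt e * vec_norm2 v"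
    using arg_cong[OF v(5), of sqrt] vec_norm2_nonneg by (simp add: real_sqrt_mult)
  then show thesis using that[OF v(1,2)] v(3,4) s by simp
qed

lemma singular_value_nonneg:
  assumes "M \<in> carrier_mat n n" "1 \<le> i" "i \<le> n" shows "0 \<le> singular_value i M"
  using singular_value_eigenvector[OF assms] .

text \<open>The Rayleigh quotient of the Gram matrix is bounded by some eigenvalue \<open>e\<close>.
  This \<open>e\<close> occurs in the decreasing list of eigenvalues, hence is at most the first
  entry, the square of the largest singular value.\<close>

lemma vec_norm2_mult_le:
  assumes M: "M \<in> carrier_mat n n" and n: "1 \<le> n" and x: "x \<in> carrier_vec n"
  shows "vec_norm2 (M *\<^sub>v x) \<le> singular_value 1 M * vec_norm2 x"
proof -
  let ?A = "transpose_mat M * M"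
  define l where "l = rev (sorted_list_of_multiset (proots (char_poly ?A)))"
  note gl = gram_eigenvalues[OF M, folded l_def]
  have n0: "0 < n" using n by simp
  obtain e v where ev: "eigenvector ?A v e"
    and e: "\<And>x. x \<in> carrier_vec n \<Longrightarrow> x \<bullet> (?A *\<^sub>v x) \<le> e * (x \<bullet> x)"
    using sym_max_eigenvector[OF gram_carrier[OF M] gram_sym[OF M] n0] by blast
  have "e \<in> set l" using ev gl(3) by (auto simp: eigenvalue_def)
  then obtain j where j: "j < n" "l ! j = e" using gl(1) by (auto simp: in_set_conv_nth)
  have "e \<le> l ! 0"
    using gl(1,2) j by (cases "j = 0") (auto dest: sorted_wrt_nth_less)
  moreover have "(singular_value 1 M)\<^sup>2 = l ! 0"
  proof -
    have "0 \<le> l ! 0" using singular_value_nonneg[OF M _ n] by (simp add: singular_value_def l_def)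
    then show ?thesis by (simp add: singular_value_def l_def)
  qed
  ultimately have "(vec_norm2 (M *\<^sub>v x))\<^sup>2 \<le> (singular_value 1 M)\<^sup>2 * (vec_norm2 x)\<^sup>2"
    using e[OF x] gram_quadratic_form[OF M x] scalar_prod_self_nonneg[of x]
    by (simp add: vec_norm2_sq) (meson mult_right_mono order_trans)
  then have "(vec_norm2 (M *\<^sub>v x))\<^sup>2 \<le> (singular_value 1 M * vec_norm2 x)\<^sup>2"
    by (simp add: power_mult_distrib)
  then show ?thesis
    by (rule power2_le_imp_le) (rule mult_nonneg_nonneg[OF singular_value_nonneg[OF M order_refl n] vec_norm2_nonneg])
qed

text \<open>The minimum of the Rayleigh quotient of \<open>M\<^sup>T M\<close> is the maximum of the one of \<open>- M\<^sup>T M\<close>.\<close>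
lemma vec_norm2_mult_ge:
  assumes M: "M \<in> carrier_mat n n" and n: "1 \<le> n" and x: "x \<in> carrier_vec n"
  shows "singular_value n M * vec_norm2 x \<le> vec_norm2 (M *\<^sub>v x)"
proof -
  let ?A = "transpose_mat M * M"
  note A = gram_carrier[OF M] gram_sym[OF M]
  define l where "l = rev (sorted_list_of_multiset (proots (char_poly ?A)))"
  note gl = gram_eigenvalues[OF M, folded l_def]
  have neg: "- ?A \<in> carrier_mat n n" "transpose_mat (- ?A) = - ?A"
    using A by (auto simp: transpose_uminus)
  have n0: "0 < n" using n by simp
  obtain e v where ev: "eigenvector (- ?A) v e"
    and e: "\<And>x. x \<in> carrier_vec n \<Longrightarrow> x \<bullet> ((- ?A) *\<^sub>v x) \<le> e * (x \<bullet> x)"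
    using sym_max_eigenvector[OF neg n0] by blast
  have neg_mult: "(- ?A) *\<^sub>v y = - (?A *\<^sub>v y)" if "y \<in> carrier_vec n" for y
    using A that by (intro uminus_mult_mat_vec) auto
  have v: "v \<in> carrier_vec n" "v \<noteq> 0\<^sub>v n" "- (?A *\<^sub>v v) = e \<cdot>\<^sub>v v"
    using ev M neg_mult by (auto simp: eigenvector_def)
  have "?A *\<^sub>v v = (- e) \<cdot>\<^sub>v v"
  proof -
    have "?A *\<^sub>v v = - (- (?A *\<^sub>v v))" by simp
    also have "\<dots> = (- e) \<cdot>\<^sub>v v" unfolding v(3) by auto
    finally show ?thesis .
  qed
  then have "eigenvalue ?A (- e)" using v M by (auto simp: eigenvalue_def eigenvector_def)
  then have "- e \<in> set l" using gl(3) by simp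
  then obtain j where j: "j < n" "l ! j = - e" using gl(1) by (auto simp: in_set_conv_nth)
  \<comment> \<open>The entry that \<open>singular_value n\<close> reads is the last of a decreasing
    list, so it lies below the eigenvalue \<open>- e\<close>, itself a lower bound of the Rayleigh
    quotient.\<close>
  have "l ! (n - 1) \<le> - e"
  proof (cases "j = n - 1")
    case False
    then show ?thesis using gl(1,2) j sorted_wrt_nth_less[of "(\<ge>)" l j "n - 1"] by auto
  qed (use j in simp)
  moreover have "(singular_value n M)\<^sup>2 = l ! (n - 1)"
  proof -
    have "0 \<le> l ! (n - 1)" using singular_value_nonneg[OF M n] by (simp add: singular_value_def l_def)
    then show ?thesis by (simp add: singular_value_def l_def)
  qed
  moreover have "- e * (x \<bullet> x) \<le> (vec_norm2 (M *\<^sub>v x))\<^sup>2"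
    using e[OF x] gram_quadratic_form[OF M x] neg_mult[OF x] x M by simp
  ultimately have "(singular_value n M)\<^sup>2 * (vec_norm2 x)\<^sup>2 \<le> (vec_norm2 (M *\<^sub>v x))\<^sup>2"
    using scalar_prod_self_nonneg[of x]
    by (simp only: vec_norm2_sq) (meson mult_right_mono order_trans)
  then have "(singular_value n M * vec_norm2 x)\<^sup>2 \<le> (vec_norm2 (M *\<^sub>v x))\<^sup>2"
    by (simp add: power_mult_distrib)
  then show ?thesis
    using vec_norm2_nonneg by (rule power2_le_imp_le)
qed

text \<open>For \<open>y = M^T x\<close>, Cauchy-Schwarz bounds
  \<open>y \<bullet> y = x \<bullet> (M y)\<close> by the norm of \<open>x\<close> times that of
  \<open>M y\<close>; one factor, the norm of \<open>y\<close>, then cancels. No comparison of the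
  spectra of \<open>M^T M\<close> and \<open>M M^T\<close> is involved.\<close>

lemma vec_norm2_transpose_mult_le:
  assumes M: "M \<in> carrier_mat n n" and n: "1 \<le> n" and x: "x \<in> carrier_vec n"
  shows "vec_norm2 (transpose_mat M *\<^sub>v x) \<le> singular_value 1 M * vec_norm2 x"
proof -
  let ?y = "transpose_mat M *\<^sub>v x"
  have y: "?y \<in> carrier_vec n" using M x by auto
  have "vec_norm2 ?y * vec_norm2 ?y = ?y \<bullet> ?y" using vec_norm2_sq[of ?y] by (simp add: power2_eq_square)
  also have "\<dots> = x \<bullet> (M *\<^sub>v ?y)" using transpose_vec_mult_scalar[OF M y x] by simp
  also have "\<dots> \<le> vec_norm2 x * vec_norm2 (M *\<^sub>v ?y)"
    using M x y by (intro scalar_prod_le_vec_norm2[of _ n]) auto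
  also have "\<dots> \<le> vec_norm2 x * (singular_value 1 M * vec_norm2 ?y)"
    using vec_norm2_mult_le[OF M n y] vec_norm2_nonneg by (intro mult_left_mono) auto
  finally have "vec_norm2 ?y * vec_norm2 ?y \<le> (singular_value 1 M * vec_norm2 x) * vec_norm2 ?y"
    by (simp add: ac_simps)
  then show ?thesis
    using vec_norm2_nonneg[of ?y] vec_norm2_nonneg[of x] singular_value_nonneg[OF M _ n]
    by (cases "vec_norm2 ?y = 0") auto
qed

subsection \<open>Perturbation of the Gram matrix\<close>

text \<open>Each coordinate of \<open>E x\<close> is at most \<open>e\<close> times the sum of the
  \<open>\<bar>x $ j\<bar>\<close>, which costs one factor \<open>sqrt n\<close> by Cauchy-Schwarz;
  collecting \<open>n\<close> coordinates costs the other.\<close>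

lemma vec_norm2_mult_le_entries:
  assumes E: "E \<in> carrier_mat n n" and x: "x \<in> carrier_vec n"
    and e: "\<And>i j. i < n \<Longrightarrow> j < n \<Longrightarrow> \<bar>E $$ (i,j)\<bar> \<le> e"
  shows "vec_norm2 (E *\<^sub>v x) \<le> real n * e * vec_norm2 x"
proof (cases "n = 0")
  case False
  then have "e \<ge> 0" using e[of 0 0] by simp
  have 1: "\<bar>(E *\<^sub>v x) $ i\<bar> \<le> e * (sqrt (real n) * vec_norm2 x)" if "i < n" for i
  proof -
    have "\<bar>(E *\<^sub>v x) $ i\<bar> = \<bar>\<Sum>j<n. E $$ (i,j) * x $ j\<bar>"
      using that E x by (simp add: mult_mat_vec_def scalar_prod_def row_def atLeast0LessThan)
    also have "\<dots> \<le> (\<Sum>j<n. e * (\<bar>1\<bar> * \<bar>x $ j\<bar>))"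
      using that e by (intro order_trans[OF sum_abs] sum_mono) (auto simp: abs_mult intro!: mult_right_mono)
    also have "\<dots> \<le> e * (sqrt (real n) * vec_norm2 x)"
      using L2_set_mult_ineq[of "\<lambda>_. 1" "($) x" "{..<n}"] x \<open>e \<ge> 0\<close>
      by (auto simp: sum_distrib_left[symmetric] L2_set_constant vec_norm2_def intro!: mult_left_mono)
    finally show ?thesis .
  qed
  have "vec_norm2 (E *\<^sub>v x) = L2_set (\<lambda>i. \<bar>(E *\<^sub>v x) $ i\<bar>) {..<n}"
    using E by (simp add: vec_norm2_def L2_set_def)
  also have "\<dots> \<le> L2_set (\<lambda>i. e * (sqrt (real n) * vec_norm2 x)) {..<n}"
    using 1 by (intro L2_set_mono) auto
  also have "\<dots> = real n * e * vec_norm2 x"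
    using \<open>e \<ge> 0\<close> vec_norm2_nonneg[of x] by (simp add: L2_set_constant abs_mult)
  finally show ?thesis .
qed (use E x in \<open>simp add: vec_norm2_def\<close>)

text \<open>By Cauchy-Schwarz, the entry is at most the product of the norms of columns \<open>i\<close> and \<open>j\<close> of \<open>M\<close>.\<close>
lemma abs_gram_entry_le:
  assumes M: "M \<in> carrier_mat n n" and ij: "i < n" "j < n"
  shows "(map_mat abs (transpose_mat M) * map_mat abs M) $$ (i,j) \<le> (singular_value 1 M)\<^sup>2"
proof -
  have n: "1 \<le> n" using ij by simp
  \<comment> \<open>A column is the image of a unit vector, so its norm is at most the largest
    singular value.\<close>
  have col: "L2_set (\<lambda>k. M $$ (k,j)) {..<n} \<le> singular_value 1 M" if "j < n" for j
  proof -
    have "vec_norm2 (M *\<^sub>v unit_vec n j) \<le> singular_value 1 M * vec_norm2 (unit_vec n j)"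
      by (rule vec_norm2_mult_le[OF M n]) simp
    moreover have "M *\<^sub>v unit_vec n j = col M j"
      using M that by (intro eq_vecI) auto
    moreover have "(vec_norm2 (unit_vec n j))\<^sup>2 = 1\<^sup>2" using that by (simp add: vec_norm2_sq)
    then have "vec_norm2 (unit_vec n j) = 1" by (metis abs_of_nonneg one_power2 power2_eq_1_iff vec_norm2_nonneg abs_minus_cancel abs_one)
    ultimately show ?thesis using M that by (simp add: vec_norm2_def col_def cong: L2_set_cong_simp)
  qed
  have "(map_mat abs (transpose_mat M) * map_mat abs M) $$ (i,j) = (\<Sum>k<n. \<bar>M $$ (k,i)\<bar> * \<bar>M $$ (k,j)\<bar>)"
    using M ij by (simp add: scalar_prod_def atLeast0LessThan)
  also have "\<dots> \<le> L2_set (\<lambda>k. M $$ (k,i)) {..<n} * L2_set (\<lambda>k. M $$ (k,j)) {..<n}"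
    by (rule L2_set_mult_ineq)
  also have "\<dots> \<le> singular_value 1 M * singular_value 1 M"
    using ij col by (intro mult_mono singular_value_nonneg[OF M _ n]) auto
  finally show ?thesis by (simp add: power2_eq_square)
qed

text \<open>If the largest singular value were zero, \<open>M\<close> would annihilate a unit
  vector, which an inverse forbids. The positivity permits division by it later.\<close>

lemma singular_value_1_pos:
  assumes M: "M \<in> carrier_mat n n" "invertible_mat M" and n: "1 \<le> n"
  shows "0 < singular_value 1 M"
proof -
  obtain B where "inverts_mat M B" "inverts_mat B M"
    using M by (auto simp: invertible_mat_def)
  then have MB: "M * B = 1\<^sub>m n" and BM: "B * M = 1\<^sub>m (dim_row B)"
    using M by (auto simp: inverts_mat_def)
  \<comment> \<open>\<open>inverts_mat\<close> does not fix the shape of \<open>B\<close>; it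
    follows from the column counts in the two identities.\<close>
  have dims: "B \<in> carrier_mat n n"
    using arg_cong[OF MB, of dim_col] arg_cong[OF BM, of dim_col] M(1) by auto
  have "singular_value 1 M \<noteq> 0"
  proof
    assume "singular_value 1 M = 0"
    then have *: "vec_norm2 (M *\<^sub>v unit_vec n 0) \<le> 0"
      using vec_norm2_mult_le[OF M(1) n, of "unit_vec n 0"] by simp
    have "M *\<^sub>v unit_vec n 0 = 0\<^sub>v n"
      using vec_norm2_pos[of "M *\<^sub>v unit_vec n 0" n] * M(1) by fastforce
    then have "B *\<^sub>v (M *\<^sub>v unit_vec n 0) = 0\<^sub>v n" using dims by auto
    moreover have "B *\<^sub>v (M *\<^sub>v unit_vec n 0) = unit_vec n 0"
      using BM dims M(1) by (simp flip: assoc_mult_mat_vec[of _ n n])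
    ultimately show False using n by simp
  qed
  then show ?thesis using singular_value_nonneg[OF M(1) _ n] by simp
qed

section \<open>Extreme singular values of the computed Gram matrix\<close>

context
  fixes u :: real and n :: nat and R F :: "real mat"
  assumes fl: "fl_gram u n R F" and R: "R \<in> carrier_mat n n" and n: "1 \<le> n"
    and u: "0 \<le> u" "real n * u < 1"
begin

text \<open>Common source of both singular value bounds: the triangle inequality for
  \<open>F = R^T R + E\<close>, with the rounding error \<open>E\<close> estimated
  entrywise.\<close>

lemma vec_norm2_fl_gram_mult_le:
  assumes x: "x \<in> carrier_vec n"
  shows "vec_norm2 (F *\<^sub>v x) \<le> vec_norm2 ((transpose_mat R * R) *\<^sub>v x)
           + real n * gamma_const u n * (singular_value 1 R)\<^sup>2 * vec_norm2 x"
proof -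
  define E where "E = F - transpose_mat R * R"
  have F: "F \<in> carrier_mat n n" using fl by (simp add: fl_gram_def)
  have E: "E \<in> carrier_mat n n" using F R by (auto simp: E_def)
  have g: "0 \<le> gamma_const u n" using u by (simp add: gamma_const_def)
  have "\<bar>E $$ (i,j)\<bar> \<le> gamma_const u n * (singular_value 1 R)\<^sup>2" if ij: "i < n" "j < n" for i j
  proof -
    have "map_mat abs E \<le> gamma_const u n \<cdot>\<^sub>m (map_mat abs (transpose_mat R) * map_mat abs R)"
      using fl u(2) by (simp add: fl_gram_def E_def)
    then have "map_mat abs E $$ (i,j) \<le> (gamma_const u n \<cdot>\<^sub>m (map_mat abs (transpose_mat R) * map_mat abs R)) $$ (i,j)"
      using ij R by (auto simp: less_eq_mat_def)
    then have "\<bar>E $$ (i,j)\<bar> \<le> gamma_const u n * (map_mat abs (transpose_mat R) * map_mat abs R) $$ (i,j)"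
      using ij R E by simp
    also have "\<dots> \<le> gamma_const u n * (singular_value 1 R)\<^sup>2"
      using abs_gram_entry_le[OF R ij] g by (rule mult_left_mono)
    finally show ?thesis .
  qed
  then have "vec_norm2 (E *\<^sub>v x) \<le> real n * (gamma_const u n * (singular_value 1 R)\<^sup>2) * vec_norm2 x"
    by (rule vec_norm2_mult_le_entries[OF E x])
  moreover have "F = transpose_mat R * R + E"
    using F R by (intro eq_matI) (auto simp: E_def)
  then have "F *\<^sub>v x = (transpose_mat R * R) *\<^sub>v x + E *\<^sub>v x"
    using R E x by (simp add: add_mult_distrib_mat_vec[of _ n n])
  then have "vec_norm2 (F *\<^sub>v x) \<le> vec_norm2 ((transpose_mat R * R) *\<^sub>v x) + vec_norm2 (E *\<^sub>v x)"
    using R E x vec_norm2_add[of _ n] by auto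
  ultimately show ?thesis by (simp add: mult.assoc)
qed

lemma singular_value_n_fl_gram_le:
  "singular_value n F \<le> (singular_value n R)\<^sup>2 + real n * gamma_const u n * (singular_value 1 R)\<^sup>2"
proof -
  have F: "F \<in> carrier_mat n n" using fl by (simp add: fl_gram_def)
  obtain v where v: "v \<in> carrier_vec n" "v \<noteq> 0\<^sub>v n"
    "(transpose_mat R * R) *\<^sub>v v = (singular_value n R)\<^sup>2 \<cdot>\<^sub>v v"
    using singular_value_eigenvector[OF R n order_refl] by metis
  have "singular_value n F * vec_norm2 v \<le> vec_norm2 (F *\<^sub>v v)" by (rule vec_norm2_mult_ge[OF F n v(1)])
  also have "\<dots> \<le> ((singular_value n R)\<^sup>2 + real n * gamma_const u n * (singular_value 1 R)\<^sup>2) * vec_norm2 v"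
    using vec_norm2_fl_gram_mult_le[OF v(1)] by (simp add: v(3) vec_norm2_smult algebra_simps)
  finally show ?thesis using vec_norm2_pos[OF v(1,2)] by simp
qed

text \<open>Here the test vector is a first right singular vector of \<open>F\<close>, not of
  \<open>R\<close>; \<open>R^T R\<close> stretches it by at most the square of
  \<open>singular_value 1 R\<close>.\<close>

lemma singular_value_1_fl_gram_le:
  "singular_value 1 F \<le> (1 + real n * gamma_const u n) * (singular_value 1 R)\<^sup>2"
proof -
  have F: "F \<in> carrier_mat n n" using fl by (simp add: fl_gram_def)
  obtain v where v: "v \<in> carrier_vec n" "v \<noteq> 0\<^sub>v n"
    "vec_norm2 (F *\<^sub>v v) = singular_value 1 F * vec_norm2 v"
    using singular_value_eigenvector[OF F order_refl n] by metis
  have "vec_norm2 ((transpose_mat R * R) *\<^sub>v v) = vec_norm2 (transpose_mat R *\<^sub>v (R *\<^sub>v v))"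
    using R v by (simp add: assoc_mult_mat_vec[of _ n n])
  also have "\<dots> \<le> singular_value 1 R * vec_norm2 (R *\<^sub>v v)"
    using R v by (intro vec_norm2_transpose_mult_le[OF R n]) auto
  also have "\<dots> \<le> singular_value 1 R * (singular_value 1 R * vec_norm2 v)"
    by (intro mult_left_mono vec_norm2_mult_le[OF R n v(1)] singular_value_nonneg[OF R _ n]) simp
  finally have "singular_value 1 F * vec_norm2 v \<le> ((1 + real n * gamma_const u n) * (singular_value 1 R)\<^sup>2) * vec_norm2 v"
    using vec_norm2_fl_gram_mult_le[OF v(1)] v(3) by (simp add: algebra_simps power2_eq_square)
  then show ?thesis using vec_norm2_pos[OF v(1,2)] by simp
qed

end

subsection \<open>Asymptotics\<close>

theorem theorem7:
  fixes u :: "nat \<Rightarrow> real" and n :: "nat \<Rightarrow> nat" and R F :: "nat \<Rightarrow> real mat" and t :: "nat \<Rightarrow> real"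
  assumes u: "\<And>k. 0 < u k \<and> u k < 1"
    and n: "\<And>k. n k \<ge> 1"
    and R: "\<And>k. R k \<in> carrier_mat (n k) (n k)" "\<And>k. invertible_mat (R k)"
    and F: "\<And>k. fl_gram (u k) (n k) (R k) (F k)"
    and lim: "(\<lambda>k. real (n k) * sqrt (u k)) \<longlonglongrightarrow> 0"
    and cond: "(\<lambda>k. 1 / cond_number (R k)) \<in> o(\<lambda>k. real (n k) * sqrt (u k))"
    and t: "\<And>k. real (n k) * u k < 1 \<Longrightarrow>
      singular_value (n k) (F k) =
        (singular_value (n k) (R k))\<^sup>2
        + t k * real (n k) * gamma_const (u k) (n k) * (singular_value 1 (R k))\<^sup>2"
    and generic: "\<exists>c>0. eventually (\<lambda>k. \<bar>t k\<bar> \<ge> c) sequentially"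
  shows "eventually (\<lambda>k. t k > 0) sequentially
    \<and> t \<in> O(\<lambda>k. 1)
    \<and> (\<lambda>k. 1 / t k) \<in> O(\<lambda>k. 1)
    \<and> ((\<lambda>k. singular_value (n k) (F k) /
           ((singular_value 1 (R k))\<^sup>2 * t k * (real (n k))\<^sup>2 * u k)) \<longlonglongrightarrow> 1)
    \<and> (\<lambda>k. cond_number (F k)) \<in> O(\<lambda>k. 1 / ((real (n k))\<^sup>2 * u k))"
proof -
  obtain c where c: "c > 0" "eventually (\<lambda>k. \<bar>t k\<bar> \<ge> c) sequentially" using generic by blast
  \<comment> \<open>\<open>h\<close> is the relative size \<open>n^2 u\<close> of the perturbation,
    and \<open>rho\<close> measures the exact smallest eigenvalue of \<open>R^T R\<close> on the
    scale of \<open>h\<close> times the largest one.\<close>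
  define N s f h rho where "N k = real (n k)" and "s k = singular_value 1 (R k)"
    and "f k = singular_value (n k) (F k)" and "h k = (N k)\<^sup>2 * u k"
    and "rho k = (singular_value (n k) (R k) / s k)\<^sup>2 / h k" for k
  have Fc: "F k \<in> carrier_mat (n k) (n k)" for k using F[of k] by (simp add: fl_gram_def)
  have s_pos: "s k > 0" for k unfolding s_def using R n by (rule singular_value_1_pos)
  have N: "N k \<ge> 1" for k using n[of k] by (simp add: N_def)
  have h_pos: "h k > 0" for k using N[of k] u[of k] by (simp add: h_def)
  have f_nonneg: "f k \<ge> 0" for k
    unfolding f_def using n by (intro singular_value_nonneg[OF Fc]) auto
  have rho_nonneg: "rho k \<ge> 0" for k using h_pos[of k] by (simp add: rho_def)
  have h_sqrt: "h k = (N k * sqrt (u k))\<^sup>2" for k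
    using u[of k] by (simp add: h_def power_mult_distrib)
  have h_lim: "h \<longlonglongrightarrow> 0"
    using tendsto_power[OF lim, of 2] by (simp add: h_sqrt[abs_def] N_def)
  \<comment> \<open>As \<open>n\<close> is at least 1, smallness of \<open>h\<close> also makes
    \<open>n u\<close> small.\<close>
  have Nu_bounds: "0 < N k * u k" "N k * u k \<le> h k" for k
    using u[of k] N[of k] by (simp_all add: h_def power2_eq_square)
  have Nu_lim: "(\<lambda>k. N k * u k) \<longlonglongrightarrow> 0"
    using Nu_bounds by (intro real_tendsto_sandwich[OF _ _ tendsto_const h_lim]) (auto simp: less_imp_le)
  \<comment> \<open>\<open>rho\<close> is the square of the quotient that the little-o hypothesis
    sends to zero.\<close>
  have rho_lim: "rho \<longlonglongrightarrow> 0"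
  proof -
    have "(\<lambda>k. (1 / cond_number (R k) / (N k * sqrt (u k)))\<^sup>2) \<longlonglongrightarrow> 0"
      using tendsto_power[OF smalloD_tendsto[OF cond], of 2] by (simp add: N_def)
    moreover have "dim_row (R k) = n k" for k using R(1)[of k] by simp
    then have "rho = (\<lambda>k. (1 / cond_number (R k) / (N k * sqrt (u k)))\<^sup>2)"
      by (simp add: fun_eq_iff rho_def h_sqrt cond_number_def s_def power_divide power_mult_distrib)
    ultimately show ?thesis by (simp only:)
  qed
  \<comment> \<open>Below the threshold 1/2 also \<open>n u < 1/2\<close>, so the rounding bound and
    the equation for \<open>t\<close> apply and \<open>1 / (1 - n u)\<close> lies between 1 and
    2.\<close>
  have ev_h: "eventually (\<lambda>k. h k < 1/2) sequentially"
    using order_tendstoD(2)[OF h_lim, of "1/2"] by simp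
  have Ng: "N k * gamma_const (u k) (n k) = h k / (1 - N k * u k)" for k
    by (simp add: gamma_const_def N_def h_def power2_eq_square)
  have f_eq: "f k = (s k)\<^sup>2 * h k * (rho k + t k / (1 - N k * u k))" if "h k < 1/2" for k
  proof -
    have *: "N k * u k < 1" using that Nu_bounds(2)[of k] by simp
    have "f k = (singular_value (n k) (R k))\<^sup>2 + t k * (N k * gamma_const (u k) (n k)) * (s k)\<^sup>2"
      using t[of k] * by (simp add: f_def s_def N_def)
    also have "(singular_value (n k) (R k))\<^sup>2 = (s k)\<^sup>2 * h k * rho k"
      using s_pos[of k] h_pos[of k] by (simp add: rho_def power_divide)
    finally show ?thesis by (simp add: Ng algebra_simps)
  qed
  have inv_ge: "1 \<le> 1 / (1 - N k * u k)" "1 / (1 - N k * u k) \<le> 2" if "h k < 1/2" for k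
    using that Nu_bounds[of k] by (simp_all add: field_simps)
  have t_le: "t k \<le> 1" if hk: "h k < 1/2" for k
  proof -
    have *: "N k * u k < 1" using hk Nu_bounds(2)[of k] by simp
    have "f k \<le> (singular_value (n k) (R k))\<^sup>2 + N k * gamma_const (u k) (n k) * (s k)\<^sup>2"
      using singular_value_n_fl_gram_le[OF F R(1) n, of k] u[of k] * by (simp add: f_def N_def s_def)
    then have "t k * (N k * gamma_const (u k) (n k) * (s k)\<^sup>2) \<le> 1 * (N k * gamma_const (u k) (n k) * (s k)\<^sup>2)"
      using t[of k] * by (simp add: f_def s_def N_def mult.assoc)
    moreover have "N k * gamma_const (u k) (n k) * (s k)\<^sup>2 > 0"
      using * h_pos[of k] s_pos[of k] by (simp add: Ng)
    ultimately show ?thesis by (simp only: mult_le_cancel_right_pos)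
  qed
  \<comment> \<open>Were \<open>t k\<close> at most \<open>- c\<close>, so would be
    \<open>t k / (1 - n u)\<close>; since \<open>rho k < c\<close>, the smallest singular value
    \<open>f k\<close> would be negative.\<close>
  have ev: "eventually (\<lambda>k. h k < 1/2 \<and> c \<le> t k) sequentially"
    using ev_h c(2) order_tendstoD(2)[OF rho_lim c(1)]
  proof eventually_elim
    case (elim k)
    have "t k > 0"
    proof (rule ccontr)
      assume "\<not> t k > 0"
      with elim(2) have "t k \<le> - c" by simp
      then have "t k * (1 / (1 - N k * u k)) \<le> - c * (1 / (1 - N k * u k))"
        by (rule mult_right_mono) (use inv_ge(1)[OF elim(1)] in linarith)
      also have "\<dots> \<le> - c * 1" using inv_ge(1)[OF elim(1)] c(1) by (intro mult_left_mono_neg) auto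
      finally have "rho k + t k / (1 - N k * u k) < 0" using elim(3) by simp
      then have "f k < 0"
        unfolding f_eq[OF elim(1)] using s_pos[of k] h_pos[of k] by (intro mult_pos_neg) auto
      with f_nonneg[of k] show False by simp
    qed
    with elim show ?case by simp
  qed
  have "eventually (\<lambda>k. t k > 0) sequentially"
    using ev by eventually_elim (use c(1) in auto)
  moreover have "t \<in> O(\<lambda>k. 1)"
  proof (rule bigoI)
    show "eventually (\<lambda>k. norm (t k) \<le> 1 * norm (1::real)) sequentially"
      using ev by eventually_elim (use c(1) t_le in auto)
  qed
  moreover have "(\<lambda>k. 1 / t k) \<in> O(\<lambda>k. 1)"
  proof (rule bigoI)
    show "eventually (\<lambda>k. norm (1 / t k) \<le> (1 / c) * norm (1::real)) sequentially"
      using ev by eventually_elim (use c(1) in \<open>auto simp: frac_le\<close>)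
  qed
  moreover have "(\<lambda>k. f k / ((s k)\<^sup>2 * t k * h k)) \<longlonglongrightarrow> 1"
  proof -
    \<comment> \<open>The ratio in question is eventually \<open>rho / t + 1 / (1 - n u)\<close>.
      The first summand vanishes in the limit since \<open>t\<close> stays above \<open>c\<close>,
      and the second tends to 1.\<close>
    have "(\<lambda>k. rho k / t k) \<longlonglongrightarrow> 0"
    proof (rule real_tendsto_sandwich[OF _ _ tendsto_const])
      show "(\<lambda>k. rho k / c) \<longlonglongrightarrow> 0" using tendsto_divide[OF rho_lim tendsto_const[of c]] c(1) by simp
      show "eventually (\<lambda>k. 0 \<le> rho k / t k) sequentially"
        using ev by eventually_elim (use rho_nonneg c(1) in auto)
      show "eventually (\<lambda>k. rho k / t k \<le> rho k / c) sequentially"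
        using ev by eventually_elim (use rho_nonneg c(1) in \<open>auto intro!: divide_left_mono\<close>)
    qed
    moreover have "(\<lambda>k. 1 / (1 - N k * u k)) \<longlonglongrightarrow> 1 / (1 - 0)"
      by (intro tendsto_intros Nu_lim) simp
    ultimately have "(\<lambda>k. rho k / t k + 1 / (1 - N k * u k)) \<longlonglongrightarrow> 0 + 1 / (1 - 0)"
      by (rule tendsto_add)
    then have "(\<lambda>k. rho k / t k + 1 / (1 - N k * u k)) \<longlonglongrightarrow> 1" by simp
    moreover have "eventually (\<lambda>k. rho k / t k + 1 / (1 - N k * u k) = f k / ((s k)\<^sup>2 * t k * h k)) sequentially"
      using ev
    proof eventually_elim
      case (elim k)
      then have "t k \<noteq> 0" using c(1) by auto
      then show ?case
        using elim s_pos[of k] h_pos[of k] by (simp add: f_eq add_divide_distrib[of "rho k"] divide_simps)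
    qed
    ultimately show ?thesis by (rule Lim_transform_eventually)
  qed
  moreover have "(\<lambda>k. cond_number (F k)) \<in> O(\<lambda>k. 1 / h k)"
  proof (rule bigoI)
    \<comment> \<open>The 2 comes from \<open>1 + n \<gamma> \<le> 2\<close> in the bound on the
      largest singular value of \<open>F\<close>. The \<open>c\<close> comes from
      \<open>f k\<close>, which is at least \<open>(s k)^2 * h k * c\<close> because
      \<open>rho\<close> is nonnegative and \<open>t\<close> is at least \<open>c\<close>.\<close>
    show "eventually (\<lambda>k. norm (cond_number (F k)) \<le> (2 / c) * norm (1 / h k)) sequentially"
      using ev
    proof eventually_elim
      case (elim k)
      have *: "N k * u k < 1" using elim Nu_bounds(2)[of k] by simp
      have "N k * gamma_const (u k) (n k) \<le> 1"
        using Nu_bounds(2)[of k] elim * by (simp add: Ng pos_divide_le_eq)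
      then have "(1 + N k * gamma_const (u k) (n k)) * (s k)\<^sup>2 \<le> 2 * (s k)\<^sup>2"
        by (intro mult_right_mono) auto
      then have top: "singular_value 1 (F k) \<le> 2 * (s k)\<^sup>2"
        using singular_value_1_fl_gram_le[OF F R(1) n, of k] u[of k] * by (simp add: N_def s_def)
      have "c * 1 \<le> t k * (1 / (1 - N k * u k))"
        using elim inv_ge[of k] c(1) by (intro mult_mono) auto
      then have "(s k)\<^sup>2 * h k * c \<le> f k"
        using f_eq[of k] elim rho_nonneg[of k] h_pos[of k] by (auto intro!: mult_left_mono)
      then have "singular_value 1 (F k) / f k \<le> (2 * (s k)\<^sup>2) / ((s k)\<^sup>2 * h k * c)"
        using top s_pos[of k] h_pos[of k] c(1) by (intro frac_le) auto
      also have "\<dots> = 2 / c * (1 / h k)" using s_pos[of k] by simp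
      finally show ?case
        using singular_value_nonneg[OF Fc[of k] _ n[of k]] f_nonneg[of k] h_pos[of k] Fc[of k]
        by (simp add: cond_number_def f_def)
    qed
  qed
  ultimately show ?thesis by (simp add: f_def s_def h_def N_def mult.assoc)
qed

end
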